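(* If $\mathcal A$ is a $1$-edge differentially private mechanism that answers maximum matching size queries on graphs with $n$ vertices in the continual release model for fully dynamic streams of length $T$, such that with probability at least $0.99$ every output is within additive error $\zeta$ of the true maximum matching size, then $\zeta=\Omega(\min(\sqrt n,\,T^{1/4}))$. Moreover, this holds even if accuracy is only required on streams in which every intermediate graph is bipartite, has maximum degree $2$, and has arboricity $1$.
   Context: A fully dynamic stream of length $T$ on a fixed vertex set of size $n$ is a sequence of updates, each an edge insertion, an edge deletion, or the empty update $\bot$; the current graph after $t$ updates is induced by these updates. Two streams are edge-neighboring if they differ in exactly one timestep $t^*$, where one has $\bot$ and the other an edge insertion or deletion. A mechanism is $\varepsilon$-edge DP if for all edge-neighboring streams $S,S'$ and all output sets $Y$, $\Pr[\mathcal A(S)\in Y]\le e^\varepsilon\Pr[\mathcal A(S')\in Y]$. Arboricity is the minimum number of forests partitioning the edge set. The $\Omega$ hides an absolute constant and holds for $n$ sufficiently large. *)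

theory Defs
  imports "HOL-Probability.Probability"
begin

text \<open>A simple graph on a fixed vertex set is represented by its edge set, a set of
  two-element sets of vertices.\<close>

definition possible_edges :: "'v set \<Rightarrow> 'v set set" where
  "possible_edges V = {e. e \<subseteq> V \<and> card e = 2}"

definition is_matching :: "'v set set \<Rightarrow> 'v set set \<Rightarrow> bool" where
  "is_matching E M \<longleftrightarrow> M \<subseteq> E \<and> disjoint M"

definition max_matching_size :: "'v set set \<Rightarrow> nat" where
  "max_matching_size E = Max (card ` {M. is_matching E M})"

definition bipartite :: "'v set \<Rightarrow> 'v set set \<Rightarrow> bool" where
  "bipartite V E \<longleftrightarrow>
     (\<exists>L R. L \<union> R = V \<and> L \<inter> R = {} \<and> (\<forall>e\<in>E. \<exists>u\<in>L. \<exists>v\<in>R. e = {u, v}))"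

definition vertex_degree :: "'v set set \<Rightarrow> 'v \<Rightarrow> nat" where
  "vertex_degree E v = card {e \<in> E. v \<in> e}"

definition max_degree :: "'v set \<Rightarrow> 'v set set \<Rightarrow> nat" where
  "max_degree V E = (SUP v\<in>V. vertex_degree E v)"

definition is_cycle :: "'v set set \<Rightarrow> 'v list \<Rightarrow> bool" where
  "is_cycle E vs \<longleftrightarrow> length vs \<ge> 3 \<and> distinct vs \<and>
     (\<forall>i<length vs. {vs ! i, vs ! (Suc i mod length vs)} \<in> E)"

definition forest :: "'v set set \<Rightarrow> bool" where
  "forest E \<longleftrightarrow> (\<nexists>vs. is_cycle E vs)"

definition arboricity :: "'v set set \<Rightarrow> nat" where
  "arboricity E =
     (LEAST k. \<exists>P. finite P \<and> card P = k \<and> partition_on E P \<and> (\<forall>F\<in>P. forest F))"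

datatype 'v update = Insertion "'v set" | Deletion "'v set" | Empty_Update

fun valid_update :: "'v set \<Rightarrow> 'v update \<Rightarrow> bool" where
  "valid_update V (Insertion e) \<longleftrightarrow> e \<in> possible_edges V"
| "valid_update V (Deletion e) \<longleftrightarrow> e \<in> possible_edges V"
| "valid_update V Empty_Update \<longleftrightarrow> True"

text \<open>Inserting an edge that is present, or deleting one that is absent, has no effect.\<close>

fun apply_update :: "'v update \<Rightarrow> 'v set set \<Rightarrow> 'v set set" where
  "apply_update (Insertion e) E = insert e E"
| "apply_update (Deletion e) E = E - {e}"
| "apply_update Empty_Update E = E"

definition dynamic_streams :: "'v set \<Rightarrow> nat \<Rightarrow> 'v update list set" where
  "dynamic_streams V T = {S. length S = T \<and> (\<forall>u\<in>set S. valid_update V u)}"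

definition graph_after :: "'v update list \<Rightarrow> nat \<Rightarrow> 'v set set" where
  "graph_after S t = fold apply_update (take t S) {}"

definition edge_neighboring :: "'v update list \<Rightarrow> 'v update list \<Rightarrow> bool" where
  "edge_neighboring S S' \<longleftrightarrow> length S = length S' \<and>
     (\<exists>t<length S. (S ! t = Empty_Update) \<noteq> (S' ! t = Empty_Update) \<and>
        (\<forall>i<length S. i \<noteq> t \<longrightarrow> S ! i = S' ! i))"

text \<open>The output after the \<open>t\<close>-th update is the coordinate \<open>t \<in> {1..T}\<close> of a random real
  vector.\<close>

abbreviation output_space :: "nat \<Rightarrow> (nat \<Rightarrow> real) measure" where
  "output_space T \<equiv> (\<Pi>\<^sub>M t\<in>{1..T}. borel)"

text \<open>A mechanism maps each stream to the joint law of its outputs. The last condition says that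
  it works online: the law of the first \<open>t\<close> outputs is determined by the first \<open>t\<close>
  updates.\<close>

definition continual_release_mechanism ::
    "'v set \<Rightarrow> nat \<Rightarrow> ('v update list \<Rightarrow> (nat \<Rightarrow> real) measure) \<Rightarrow> bool" where
  "continual_release_mechanism V T A \<longleftrightarrow>
     (\<forall>S\<in>dynamic_streams V T. prob_space (A S) \<and> sets (A S) = sets (output_space T)) \<and>
     (\<forall>S\<in>dynamic_streams V T. \<forall>S'\<in>dynamic_streams V T. \<forall>t\<le>T. take t S = take t S' \<longrightarrow>
        distr (A S) (output_space t) (\<lambda>y. restrict y {1..t}) =
        distr (A S') (output_space t) (\<lambda>y. restrict y {1..t}))"

definition edge_differentially_private ::
    "real \<Rightarrow> 'v set \<Rightarrow> nat \<Rightarrow> ('v update list \<Rightarrow> (nat \<Rightarrow> real) measure) \<Rightarrow> bool" where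
  "edge_differentially_private \<epsilon> V T A \<longleftrightarrow>
     (\<forall>S\<in>dynamic_streams V T. \<forall>S'\<in>dynamic_streams V T. edge_neighboring S S' \<longrightarrow>
        (\<forall>Y\<in>sets (output_space T). measure (A S) Y \<le> exp \<epsilon> * measure (A S') Y))"

definition matching_accurate_on ::
    "'v update list set \<Rightarrow> nat \<Rightarrow> real \<Rightarrow> real \<Rightarrow>
      ('v update list \<Rightarrow> (nat \<Rightarrow> real) measure) \<Rightarrow> bool" where
  "matching_accurate_on SS T p \<zeta> A \<longleftrightarrow>
     (\<forall>S\<in>SS. measure (A S)
        {y \<in> space (A S). \<forall>t\<in>{1..T}. \<bar>y t - real (max_matching_size (graph_after S t))\<bar> \<le> \<zeta>} \<ge> p)"

text \<open>The degree and arboricity conditions are upper bounds, as every stream starts from the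
  empty graph, which has maximum degree and arboricity 0.\<close>

definition restricted_streams :: "'v set \<Rightarrow> nat \<Rightarrow> 'v update list set" where
  "restricted_streams V T = {S \<in> dynamic_streams V T. \<forall>t\<le>T.
     bipartite V (graph_after S t) \<and> max_degree V (graph_after S t) \<le> 2 \<and>
     arboricity (graph_after S t) \<le> 1}"

end

theory Submission
  imports Defs "HOL-Library.Nat_Bijection"
begin

text \<open>A database \<open>X \<subseteq> {..<m}\<close>, with \<open>m\<close> a power of two, is encoded by \<open>m\<close> disjoint three-vertex
  paths: the first edge of path \<open>i\<close> is present iff \<open>i \<in> X\<close>, so changing one bit gives a neighboring
  stream. Inserting the second edges of the paths in \<open>Q\<close> makes the maximum matching size
  \<open>|X \<union> Q| = |Q| + |X - Q|\<close>, a linear query to \<open>X\<close>. Asking the \<open>m\<close> queries given by the rows of a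
  Hadamard matrix takes \<open>m\<^sup>2\<close> updates, and by Parseval's identity answers with error below a small
  multiple of \<open>\<surd>m\<close> determine \<open>X\<close> up to \<open>m/8\<close> bits. Privacy forbids this, as it forces every bit to
  be decoded wrongly with constant probability. The bound follows with \<open>m\<close> of order
  \<open>min(n, \<surd>T)\<close>.\<close>

section \<open>Hadamard matrices and Parseval's identity\<close>

text \<open>Sylvester's construction of a \<open>2 ^ k\<close> by \<open>2 ^ k\<close> sign matrix:
  four copies of the previous matrix, the lower right one negated. Reducing indices mod
  \<open>2 ^ k\<close> selects the position inside a copy.\<close>

primrec hadamard :: "nat \<Rightarrow> nat \<Rightarrow> nat \<Rightarrow> real" where
  "hadamard 0 j i = 1"
| "hadamard (Suc k) j i =
     hadamard k (j mod 2 ^ k) (i mod 2 ^ k) * (if j \<ge> 2 ^ k \<and> i \<ge> 2 ^ k then -1 else 1)"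

lemma hadamard_cases: "hadamard k j i = 1 \<or> hadamard k j i = -1"
proof (induction k arbitrary: j i)
  case (Suc k)
  then show ?case using Suc[of "j mod 2 ^ k" "i mod 2 ^ k"] by auto
qed simp

lemma hadamard_row_0 [simp]: "hadamard k 0 i = 1"
  by (induction k arbitrary: i) auto

lemma sum_lessThan_add:
  fixes f :: "nat \<Rightarrow> 'a::comm_monoid_add"
  shows "(\<Sum>i<a + b. f i) = (\<Sum>i<a. f i) + (\<Sum>i<b. f (a + i))"
  by (induction b) (simp_all add: ac_simps)

text \<open>Induction over the blocks: if \<open>s\<close> and \<open>t\<close> are the transforms
  of the two halves of \<open>z\<close>, the upper rows yield \<open>s + t\<close> and the lower
  rows \<open>s - t\<close>, so the parallelogram law doubles the sum of squares.\<close>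

lemma hadamard_parseval:
  "(\<Sum>j<2 ^ k. (\<Sum>i<2 ^ k. hadamard k j i * z i)\<^sup>2) = 2 ^ k * (\<Sum>i<2 ^ k. (z i)\<^sup>2)"
proof (induction k arbitrary: z)
  case 0
  then show ?case by (simp add: lessThan_Suc)
next
  case (Suc k)
  define s where "s j = (\<Sum>i<2 ^ k. hadamard k j i * z i)" for j
  define t where "t j = (\<Sum>i<2 ^ k. hadamard k j i * z (2 ^ k + i))" for j
  have two: "(2::nat) ^ Suc k = 2 ^ k + 2 ^ k" by simp
  have low: "(\<Sum>i<2 ^ Suc k. hadamard (Suc k) j i * z i) = s j + t j" if "j < 2 ^ k" for j
    unfolding two sum_lessThan_add s_def t_def using that by simp
  have high: "(\<Sum>i<2 ^ Suc k. hadamard (Suc k) (2 ^ k + j) i * z i) = s j - t j"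
    if "j < 2 ^ k" for j
    unfolding two sum_lessThan_add s_def t_def using that by (simp add: sum_negf)
  have "(\<Sum>j<2 ^ Suc k. (\<Sum>i<2 ^ Suc k. hadamard (Suc k) j i * z i)\<^sup>2)
      = (\<Sum>j<2 ^ k. (\<Sum>i<2 ^ Suc k. hadamard (Suc k) j i * z i)\<^sup>2)
      + (\<Sum>j<2 ^ k. (\<Sum>i<2 ^ Suc k. hadamard (Suc k) (2 ^ k + j) i * z i)\<^sup>2)"
    by (subst two, subst sum_lessThan_add) (rule refl)
  also have "\<dots> = (\<Sum>j<2 ^ k. (s j + t j)\<^sup>2) + (\<Sum>j<2 ^ k. (s j - t j)\<^sup>2)"
    by (intro arg_cong2[where f = "(+)"] sum.cong refl arg_cong[where f = "\<lambda>x. x\<^sup>2"])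
      (simp_all only: low high lessThan_iff)
  also have "\<dots> = 2 * ((\<Sum>j<2 ^ k. (s j)\<^sup>2) + (\<Sum>j<2 ^ k. (t j)\<^sup>2))"
    unfolding sum.distrib[symmetric] sum_distrib_left
    by (intro sum.cong) (simp_all add: power2_eq_square algebra_simps)
  also have "\<dots> = 2 ^ Suc k * ((\<Sum>i<2 ^ k. (z i)\<^sup>2) + (\<Sum>i<2 ^ k. (z (2 ^ k + i))\<^sup>2))"
    unfolding s_def t_def Suc.IH Suc.IH[of "\<lambda>i. z (2 ^ k + i)"] by (simp add: algebra_simps)
  also have "\<dots> = 2 ^ Suc k * (\<Sum>i<2 ^ Suc k. (z i)\<^sup>2)"
    unfolding two sum_lessThan_add by simp
  finally show ?case .
qed

section \<open>Privacy against reconstruction\<close>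

text \<open>Groups the databases into pairs that differ only in bit \<open>i\<close>, the pairs to
  which privacy applies.\<close>

lemma sum_Pow_pair:
  fixes f :: "'a set \<Rightarrow> real"
  assumes "finite A" "i \<in> A"
  shows "(\<Sum>X\<in>Pow A. f X) = (\<Sum>X\<in>Pow (A - {i}). f X + f (insert i X))"
proof -
  have "A = insert i (A - {i})" using assms by auto
  then have "Pow A = Pow (A - {i}) \<union> insert i ` Pow (A - {i})"
    using Pow_insert by metis
  moreover have "inj_on (insert i) (Pow (A - {i}))"
    by (intro inj_onI) auto
  moreover have "Pow (A - {i}) \<inter> insert i ` Pow (A - {i}) = {}" by auto
  ultimately show ?thesis
    using assms by (simp add: sum.union_disjoint sum.reindex sum.distrib)
qed

lemma sum_indicator_real:
  "finite A \<Longrightarrow> (\<Sum>i\<in>A. indicator B i :: real) = real (card (A \<inter> B))"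
  by (simp add: indicator_def of_bool_def sum.If_cases Int_def)

text \<open>Otherwise a random database could be decoded up to \<open>m/8\<close> bits. But every bit is decoded wrongly
  with probability at least 1/4, since the error probabilities \<open>p, p'\<close> for its two values satisfy
  \<open>1 - p \<le> e p'\<close> and \<open>1 - p' \<le> e p\<close>.\<close>

lemma private_ambiguous_databases:
  fixes M :: "nat set \<Rightarrow> 'a measure"
  assumes m: "m > 0"
    and prob: "\<And>X. X \<subseteq> {..<m} \<Longrightarrow> prob_space (M X)"
    and sets: "\<And>X. X \<subseteq> {..<m} \<Longrightarrow> sets (M X) = sets N"
    and dp: "\<And>X i Y. \<lbrakk>X \<subseteq> {..<m}; i < m; i \<notin> X; Y \<in> sets N\<rbrakk> \<Longrightarrow>
      measure (M X) Y \<le> exp 1 * measure (M (insert i X)) Y \<and>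
      measure (M (insert i X)) Y \<le> exp 1 * measure (M X) Y"
    and G: "\<And>X. X \<subseteq> {..<m} \<Longrightarrow> G X \<in> sets N"
    and acc: "\<And>X. X \<subseteq> {..<m} \<Longrightarrow> measure (M X) (G X) \<ge> 0.99"
  obtains X X' y where "X \<subseteq> {..<m}" "X' \<subseteq> {..<m}" "y \<in> G X" "y \<in> G X'"
    "real (card (sym_diff X X')) > real m / 8"
proof (rule ccontr)
  note ambiguous = that
  assume "\<not> thesis"
  have near: "real (card (sym_diff X X')) \<le> real m / 8"
    if "X \<subseteq> {..<m}" "X' \<subseteq> {..<m}" "y \<in> G X" "y \<in> G X'" for X X' y
    using ambiguous[OF that] \<open>\<not> thesis\<close> by (meson not_less)
  \<comment> \<open>Numbering the databases by naturals lets the decoder \<open>dec\<close> return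
    the first database consistent with \<open>y\<close>. As a \<open>LEAST\<close> over measurable
    predicates, this choice is measurable.\<close>
  define db where "db k = set_decode k \<inter> {..<m}" for k
  have db: "db k \<subseteq> {..<m}" for k by (auto simp: db_def)
  have db_surj: "\<exists>k. db k = X" if "X \<subseteq> {..<m}" for X
    by (rule exI[of _ "set_encode X"])
      (use that in \<open>auto simp: db_def set_encode_inverse finite_subset[OF that]\<close>)
  define dec where "dec y = db (LEAST k. y \<in> G (db k))" for y
  have dec: "dec y \<subseteq> {..<m}" for y by (simp add: dec_def db)
  have dec_G: "y \<in> G (dec y)" if "y \<in> G X" "X \<subseteq> {..<m}" for X y
    using LeastI_ex[of "\<lambda>k. y \<in> G (db k)"] db_surj[OF that(2)] that(1)
    unfolding dec_def by metis
  have [measurable]: "G (db k) \<in> sets N" for k by (rule G[OF db])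
  have [measurable]: "(\<lambda>y. LEAST k. y \<in> G (db k)) \<in> measurable N (count_space UNIV)"
    by measurable
  have mW: "{y \<in> space N. i \<in> dec y} \<in> sets N" for i
    unfolding dec_def by measurable
  define W where "W i = {y \<in> space N. i \<in> dec y}" for i
  define err where "err X i = {y \<in> space N. i \<in> sym_diff X (dec y)}" for X i
  have err_sets: "err X i \<in> sets N" for X i
  proof -
    have "err X i = (if i \<in> X then space N - W i else W i)" by (auto simp: err_def W_def)
    then show ?thesis using mW[of i] by (auto simp: W_def)
  qed
  \<comment> \<open>The two error events are \<open>W i\<close> and its complement. With
    \<open>s\<close> the sum of their probabilities, adding the privacy inequalities for
    \<open>W i\<close> and for its complement gives \<open>2 - s \<le> 3 * s\<close>, since e is at
    most 3.\<close>
  have lower: "measure (M X) (err X i) + measure (M (insert i X)) (err (insert i X) i) \<ge> 1/2"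
    if X: "X \<subseteq> {..<m}" "i < m" "i \<notin> X" for X i
  proof -
    define X' where "X' = insert i X"
    have X': "X' \<subseteq> {..<m}" using X by (auto simp: X'_def)
    interpret P: prob_space "M X" by (rule prob[OF X(1)])
    interpret P': prob_space "M X'" by (rule prob[OF X'])
    have sp: "space (M X) = space N" "space (M X') = space N"
      by (intro sets_eq_imp_space_eq sets X X')+
    have e: "err X i = W i" "err X' i = space N - W i"
      using X by (auto simp: err_def W_def X'_def)
    have WN: "W i \<in> sets N" using mW by (simp add: W_def)
    have c: "P.prob (space N - W i) = 1 - P.prob (W i)" "P'.prob (space N - W i) = 1 - P'.prob (W i)"
      using P.prob_compl[of "W i"] P'.prob_compl[of "W i"] WN sets X X' sp by auto
    have "P'.prob (W i) \<le> exp 1 * P.prob (W i)"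
      using dp[OF X WN] by (simp add: X'_def)
    also have "\<dots> \<le> 3 * P.prob (W i)"
      by (intro mult_right_mono exp_le measure_nonneg)
    finally have 1: "P'.prob (W i) \<le> 3 * P.prob (W i)" .
    have "P.prob (space N - W i) \<le> exp 1 * P'.prob (space N - W i)"
      using dp[OF X sets.compl_sets[OF WN]] by (simp add: X'_def)
    also have "\<dots> \<le> 3 * P'.prob (space N - W i)"
      by (intro mult_right_mono exp_le measure_nonneg)
    finally show ?thesis using 1 c unfolding X'_def[symmetric] e by linarith
  qed
  \<comment> \<open>The sum is the expected number of wrong bits. Leaving \<open>G X\<close> costs
    at most 1/100 per bit. On \<open>G X\<close>, both \<open>X\<close> and \<open>dec y\<close> are
    consistent with \<open>y\<close>, so \<open>near\<close> bounds the number of wrong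
    bits.\<close>
  have upper: "(\<Sum>i<m. measure (M X) (err X i)) \<le> real m / 8 + real m / 100"
    if X: "X \<subseteq> {..<m}" for X
  proof -
    interpret P: prob_space "M X" by (rule prob[OF X])
    have sp: "space (M X) = space N" by (intro sets_eq_imp_space_eq sets X)
    have s: "sets (M X) = sets N" by (rule sets[OF X])
    have ms: "err X i \<in> P.events" "G X \<in> P.events" "err X i \<inter> G X \<in> P.events" for i
      using err_sets G[OF X] by (auto simp: s)
    have "P.prob (err X i) \<le> P.prob (err X i \<inter> G X) + 1/100" for i
    proof -
      have "P.prob (err X i) \<le> P.prob ((err X i \<inter> G X) \<union> (space (M X) - G X))"
        by (intro P.finite_measure_mono sets.Un sets.compl_sets ms) (auto simp: err_def sp)
      also have "\<dots> \<le> P.prob (err X i \<inter> G X) + P.prob (space (M X) - G X)"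
        by (intro measure_Un_le sets.compl_sets ms)
      also have "P.prob (space (M X) - G X) = 1 - P.prob (G X)"
        by (rule P.prob_compl[OF ms(2)])
      finally show ?thesis using acc[OF X] by simp
    qed
    then have "(\<Sum>i<m. P.prob (err X i)) \<le> (\<Sum>i<m. P.prob (err X i \<inter> G X) + 1/100)"
      by (intro sum_mono)
    also have "\<dots> = (\<Sum>i<m. P.prob (err X i \<inter> G X)) + real m / 100"
      by (simp add: sum.distrib)
    also have "(\<Sum>i<m. P.prob (err X i \<inter> G X))
        = (\<Sum>i<m. P.expectation (indicator (err X i \<inter> G X)))"
      by (intro sum.cong refl, subst Bochner_Integration.integral_indicator)
         (use ms sets.sets_into_space in \<open>auto simp: Int_absorb2\<close>)
    also have "\<dots> = P.expectation (\<lambda>y. \<Sum>i<m. indicator (err X i \<inter> G X) y)"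
      by (rule Bochner_Integration.integral_sum[symmetric])
         (use ms in \<open>auto simp: P.emeasure_eq_measure intro!: integrable_real_indicator\<close>)
    also have "\<dots> \<le> P.expectation (\<lambda>y. real m / 8)"
    proof (rule integral_mono)
      show "integrable (M X) (\<lambda>y. \<Sum>i<m. indicator (err X i \<inter> G X) y :: real)"
        by (rule Bochner_Integration.integrable_sum)
         (use ms in \<open>auto simp: P.emeasure_eq_measure intro!: integrable_real_indicator\<close>)
      fix y assume y: "y \<in> space (M X)"
      show "(\<Sum>i<m. indicator (err X i \<inter> G X) y) \<le> real m / 8"
      proof (cases "y \<in> G X")
        case True
        have "(\<Sum>i<m. indicator (err X i \<inter> G X) y :: real)
            = (\<Sum>i<m. indicator (sym_diff X (dec y)) i)"
          by (intro sum.cong) (use True y in \<open>auto simp: err_def sp indicator_def\<close>)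
        also have "\<dots> = real (card ({..<m} \<inter> sym_diff X (dec y)))"
          by (simp add: sum_indicator_real)
        also have "{..<m} \<inter> sym_diff X (dec y) = sym_diff X (dec y)"
          using X dec[of y] by blast
        also have "real (card (sym_diff X (dec y))) \<le> real m / 8"
          by (rule near[OF X dec True dec_G[OF True X]])
        finally show ?thesis .
      qed simp
    qed simp
    also have "\<dots> = real m / 8" by (simp add: P.prob_space)
    finally show ?thesis by simp
  qed
  \<comment> \<open>Double counting of errors over all databases and bits: each neighboring pair
    contributes at least 1/2, while \<open>upper\<close> allows only 2 * (1/8 + 1/100) = 27/100 per
    pair on average.\<close>
  have "real m * 2 ^ (m - 1) / 2 = (\<Sum>i<m. \<Sum>X\<in>Pow ({..<m} - {i}). 1/2 :: real)"
    by (simp add: card_Pow)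
  also have "\<dots> \<le> (\<Sum>i<m. \<Sum>X\<in>Pow ({..<m} - {i}).
      measure (M X) (err X i) + measure (M (insert i X)) (err (insert i X) i))"
    by (intro sum_mono lower) auto
  also have "\<dots> = (\<Sum>i<m. \<Sum>X\<in>Pow {..<m}. measure (M X) (err X i))"
    by (intro sum.cong refl sum_Pow_pair[symmetric]) auto
  also have "\<dots> = (\<Sum>X\<in>Pow {..<m}. \<Sum>i<m. measure (M X) (err X i))"
    by (rule sum.swap)
  also have "\<dots> \<le> (\<Sum>X\<in>Pow {..<m}. real m / 8 + real m / 100)"
    by (intro sum_mono upper) auto
  also have "\<dots> = 2 ^ m * (real m / 8 + real m / 100)"
    by (simp add: card_Pow)
  also have "(2::real) ^ m = 2 * 2 ^ (m - 1)"
    using m by (cases m) auto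
  finally have "real m * 2 ^ (m - 1) * (1 / 2) \<le> real m * 2 ^ (m - 1) * (27 / 100)"
    by (simp add: algebra_simps)
  then show False using m by simp
qed

section \<open>Disjoint unions of three-vertex paths\<close>

text \<open>Path \<open>i\<close> occupies the vertices \<open>3 * i\<close> to
  \<open>3 * i + 2\<close>. Division by 3 recovers the path, and residue 1 marks the middle vertex,
  which both edges share.\<close>

definition data_edge :: "nat \<Rightarrow> nat set" where
  "data_edge i = {3 * i, 3 * i + 1}"

definition query_edge :: "nat \<Rightarrow> nat set" where
  "query_edge i = {3 * i + 1, 3 * i + 2}"

definition path_graph :: "nat set \<Rightarrow> nat set \<Rightarrow> nat set set" where
  "path_graph P Q = data_edge ` P \<union> query_edge ` Q"

lemma Min_data_edge [simp]: "Min (data_edge i) div 3 = i"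
  and Min_query_edge [simp]: "Min (query_edge i) div 3 = i"
  by (simp_all add: data_edge_def query_edge_def)

lemma path_graph_edgeE:
  assumes "e \<in> path_graph P Q"
  obtains i where "i \<in> P \<union> Q" "e = data_edge i \<or> e = query_edge i"
  using assms by (auto simp: path_graph_def)

text \<open>The edges of one path meet in its middle vertex, so a matching has at most one edge per
  path; choosing one edge from each path that has any attains this.\<close>

lemma max_matching_size_path_graph:
  assumes "finite P" "finite Q"
  shows "max_matching_size (path_graph P Q) = card (P \<union> Q)"
  unfolding max_matching_size_def
proof (rule Max_eqI)
  have "finite (path_graph P Q)" using assms by (simp add: path_graph_def)
  then have "finite {M. M \<subseteq> path_graph P Q}" by simp
  then show "finite (card ` {M. is_matching (path_graph P Q) M})"
    by (rule finite_imageI[OF finite_subset, rotated]) (auto simp: is_matching_def)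
next
  fix k assume "k \<in> card ` {M. is_matching (path_graph P Q) M}"
  then obtain M where M: "M \<subseteq> path_graph P Q" "disjoint M" and k: "k = card M"
    by (auto simp: is_matching_def)
  let ?f = "\<lambda>e::nat set. Min e div 3"
  have mid: "?f e \<in> P \<union> Q \<and> 3 * ?f e + 1 \<in> e" if "e \<in> M" for e
    using M(1) that by (auto elim!: path_graph_edgeE dest!: subsetD)
      (simp_all add: data_edge_def query_edge_def)
  have "inj_on ?f M"
  proof (rule inj_onI)
    fix e e' assume e: "e \<in> M" "e' \<in> M" "?f e = ?f e'"
    then have "3 * ?f e + 1 \<in> e \<inter> e'" using mid by (metis IntI)
    then show "e = e'" using M(2) e(1,2) unfolding disjoint_def by blast
  qed
  moreover have "?f ` M \<subseteq> P \<union> Q" using mid by blast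
  ultimately show "k \<le> card (P \<union> Q)" unfolding k using assms by (intro card_inj_on_le) auto
next
  define g where "g i = (if i \<in> P then data_edge i else query_edge i)" for i
  have inj: "inj_on g (P \<union> Q)"
    by (rule inj_on_inverseI[where g = "\<lambda>e. Min e div 3"]) (simp add: g_def)
  have "is_matching (path_graph P Q) (g ` (P \<union> Q))"
    unfolding is_matching_def
  proof
    show "g ` (P \<union> Q) \<subseteq> path_graph P Q" by (auto simp: g_def path_graph_def)
    have div3: "v div 3 = i" if "v \<in> g i" for v i
      using that by (auto simp: g_def data_edge_def query_edge_def split: if_splits)
    show "disjoint (g ` (P \<union> Q))"
    proof (intro disjointI)
      fix a b assume "a \<in> g ` (P \<union> Q)" "b \<in> g ` (P \<union> Q)" "a \<noteq> b"
      then obtain i j where "a = g i" "b = g j" "i \<noteq> j" by blast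
      then show "a \<inter> b = {}" using div3 by blast
    qed
  qed
  then show "card (P \<union> Q) \<in> card ` {M. is_matching (path_graph P Q) M}"
    using card_image[OF inj] by force
qed

text \<open>One side consists of the middle vertices, recognized by their residue mod 3; the other
  side takes all remaining vertices.\<close>

lemma bipartite_path_graph:
  assumes "P \<subseteq> {..<m}" "Q \<subseteq> {..<m}" "3 * m \<le> n"
  shows "bipartite {..<n} (path_graph P Q)"
  unfolding bipartite_def
proof (intro exI conjI ballI)
  let ?L = "{v. v < n \<and> v mod 3 = 1}" and ?R = "{v. v < n \<and> v mod 3 \<noteq> 1}"
  show "?L \<union> ?R = {..<n}" "?L \<inter> ?R = {}" by auto
  fix e assume "e \<in> path_graph P Q"
  then obtain i where i: "i \<in> P \<union> Q" "e = data_edge i \<or> e = query_edge i"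
    by (rule path_graph_edgeE)
  then have "i < m" using assms by auto
  then have b: "3 * i + 2 < n" using assms by simp
  have L: "3 * i + 1 \<in> ?L" using b by (simp add: mod_Suc)
  have R: "3 * i \<in> ?R" "3 * i + 2 \<in> ?R" using b by (simp_all add: mod_Suc)
  from i(2) show "\<exists>u\<in>?L. \<exists>v\<in>?R. e = {u, v}"
  proof
    assume "e = data_edge i"
    then have "e = {3 * i + 1, 3 * i}" by (auto simp: data_edge_def)
    then show ?thesis using L R(1) by blast
  next
    assume "e = query_edge i"
    then have "e = {3 * i + 1, 3 * i + 2}" by (simp add: query_edge_def)
    then show ?thesis using L R(2) by blast
  qed
qed

lemma max_degree_path_graph:
  assumes "n > 0"
  shows "max_degree {..<n} (path_graph P Q) \<le> 2"
  unfolding max_degree_def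
proof (rule cSUP_least)
  fix v :: nat
  have "{e \<in> path_graph P Q. v \<in> e} \<subseteq> {data_edge (v div 3), query_edge (v div 3)}"
    by (auto elim!: path_graph_edgeE simp: data_edge_def query_edge_def)
  then have "card {e \<in> path_graph P Q. v \<in> e} \<le> card {data_edge (v div 3), query_edge (v div 3)}"
    by (intro card_mono) auto
  also have "\<dots> \<le> 2" by (simp add: card_insert_if)
  finally show "vertex_degree (path_graph P Q) v \<le> 2" by (simp add: vertex_degree_def)
qed (use assms in auto)

lemma path_graph_endpoint_neighbor:
  assumes "{u, v} \<in> path_graph P Q" "v mod 3 \<noteq> 1"
  shows "u = 3 * (v div 3) + 1"
  using assms
  by (auto elim!: path_graph_edgeE simp: data_edge_def query_edge_def doubleton_eq_iff mod_Suc)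

text \<open>Of two adjacent vertices, one is an end of its path. On a cycle both neighbors of that
  end would be the middle vertex of its path, contradicting distinctness.\<close>

lemma forest_path_graph: "forest (path_graph P Q)"
  unfolding forest_def
proof
  assume "\<exists>vs. is_cycle (path_graph P Q) vs"
  then obtain vs where len: "length vs \<ge> 3" and dist: "distinct vs"
    and E: "\<And>i. i < length vs \<Longrightarrow> {vs ! i, vs ! (Suc i mod length vs)} \<in> path_graph P Q"
    unfolding is_cycle_def by blast
  let ?l = "length vs"
  have e0: "{vs ! 0, vs ! 1} \<in> path_graph P Q" using E[of 0] len mod_less[of "Suc 0" ?l] by fastforce
  have e1: "{vs ! 1, vs ! (2 mod ?l)} \<in> path_graph P Q" using E[of 1] len by (simp add: numeral_2_eq_2)
  have el: "{vs ! (?l - 1), vs ! 0} \<in> path_graph P Q"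
    using E[of "?l - 1"] len by (cases ?l) auto
  \<comment> \<open>The end vertex is \<open>vs ! 0\<close>, with cyclic neighbors at positions 1
    and \<open>?l - 1\<close>, or else \<open>vs ! 1\<close>, with neighbors at positions 0 and
    2.\<close>
  show False
  proof (cases "vs ! 0 mod 3 = 1")
    case False
    then have "vs ! 1 = vs ! (?l - 1)"
      using path_graph_endpoint_neighbor[OF el] e0 path_graph_endpoint_neighbor[of "vs ! 1" "vs ! 0"]
      by (simp add: insert_commute)
    moreover have "1 < ?l" "?l - 1 < ?l" "1 \<noteq> ?l - 1" using len by auto
    ultimately show False using nth_eq_iff_index_eq[OF dist] by blast
  next
    case True
    have "vs ! 1 mod 3 \<noteq> 1"
      using e0 True by (auto elim!: path_graph_edgeE
        simp: data_edge_def query_edge_def doubleton_eq_iff mod_Suc)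
    then have "vs ! 0 = vs ! 2"
      using path_graph_endpoint_neighbor[OF e0] e1 len
        path_graph_endpoint_neighbor[of "vs ! 2" "vs ! 1"]
      by (simp add: insert_commute)
    moreover have "0 < ?l" "2 < ?l" using len by linarith+
    ultimately show False using nth_eq_iff_index_eq[OF dist, of 0 2] by simp
  qed
qed

lemma arboricity_le_1:
  assumes "forest E"
  shows "arboricity E \<le> 1"
proof (cases "E = {}")
  \<comment> \<open>Blocks of a partition are nonempty, so the empty graph is partitioned by
    \<open>{}\<close> rather than by \<open>{E}\<close>.\<close>
  case True
  then have "arboricity E \<le> 0"
    unfolding arboricity_def by (intro Least_le exI[of _ "{}"]) (auto simp: partition_on_def)
  then show ?thesis by simp
next
  case False
  then show ?thesis
    unfolding arboricity_def using assms
    by (intro Least_le exI[of _ "{E}"]) (auto simp: partition_on_def)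
qed

section \<open>The update streams and their graphs\<close>

text \<open>Steps \<open>t < m\<close> insert the database; for \<open>0 < j < m\<close>, the steps \<open>j * m + i\<close> with \<open>i < m\<close> install
  query \<open>j\<close>. Rewriting every query edge, with ineffective insertions and deletions where needed,
  makes it unnecessary to undo the previous query.\<close>

definition stream_update :: "(nat \<Rightarrow> nat \<Rightarrow> bool) \<Rightarrow> nat \<Rightarrow> nat set \<Rightarrow> nat \<Rightarrow> nat update" where
  "stream_update w m X t =
     (if t < m then (if t \<in> X then Insertion (data_edge t) else Empty_Update)
      else if t < m * m then
        (if w (t div m) (t mod m) then Deletion (query_edge (t mod m))
         else Insertion (query_edge (t mod m)))
      else Empty_Update)"

definition query_stream :: "(nat \<Rightarrow> nat \<Rightarrow> bool) \<Rightarrow> nat \<Rightarrow> nat \<Rightarrow> nat set \<Rightarrow> nat update list" where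
  "query_stream w m T X = map (stream_update w m X) [0..<T]"

text \<open>Evolves independently of the database. Inside a block it mixes the rewritten part of the
  new query with the rest of the old one.\<close>

primrec active_queries :: "(nat \<Rightarrow> nat \<Rightarrow> bool) \<Rightarrow> nat \<Rightarrow> nat \<Rightarrow> nat set" where
  "active_queries w m 0 = {}"
| "active_queries w m (Suc t) =
     (if t < m \<or> t \<ge> m * m then active_queries w m t
      else if w (t div m) (t mod m) then active_queries w m t - {t mod m}
      else insert (t mod m) (active_queries w m t))"

lemma data_edge_neq_query_edge: "data_edge i \<noteq> query_edge j"
  by (auto simp: data_edge_def query_edge_def doubleton_eq_iff) presburger+

lemma inj_query_edge: "inj query_edge"
  by (rule inj_on_inverseI[where g = "\<lambda>e. Min e div 3"]) simp

lemma graph_after_query_stream: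
  assumes "t \<le> T"
  shows "graph_after (query_stream w m T X) t
    = path_graph (X \<inter> {..<min t m}) (active_queries w m t)"
  using assms
proof (induction t)
  case 0
  then show ?case by (simp add: graph_after_def path_graph_def)
next
  case (Suc t)
  have "graph_after (query_stream w m T X) (Suc t)
      = apply_update (stream_update w m X t) (graph_after (query_stream w m T X) t)"
    using Suc.prems by (simp add: graph_after_def take_Suc_conv_app_nth query_stream_def)
  also have "\<dots> = apply_update (stream_update w m X t)
      (path_graph (X \<inter> {..<min t m}) (active_queries w m t))"
    using Suc by simp
  also have "\<dots> = path_graph (X \<inter> {..<min (Suc t) m}) (active_queries w m (Suc t))"
  proof (cases "t < m")
    case True
    then have "X \<inter> {..<min (Suc t) m} = (if t \<in> X then insert t (X \<inter> {..<min t m}) else X \<inter> {..<min t m})"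
      by (auto simp: less_Suc_eq min_def)
    then show ?thesis using True by (auto simp: stream_update_def path_graph_def)
  next
    case False
    then have "min (Suc t) m = m" "min t m = m" by auto
    moreover have "path_graph P Q - {query_edge i} = path_graph P (Q - {i})" for P Q i
      using inj_query_edge data_edge_neq_query_edge
      by (auto simp: path_graph_def inj_def image_iff) metis
    moreover have "insert (query_edge i) (path_graph P Q) = path_graph P (insert i Q)" for P Q i
      by (auto simp: path_graph_def)
    ultimately show ?thesis using False by (auto simp: stream_update_def)
  qed
  finally show ?case .
qed

lemma active_queries_subset: "active_queries w m t \<subseteq> {..<m}"
  by (induction t) (auto intro!: mod_less_divisor intro: gr0I)

text \<open>After \<open>m + j * m\<close> updates block \<open>j\<close> has just ended. Query 0 is
  empty by \<open>w0\<close>, so the block that inserts the database also serves as block 0.\<close>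

lemma active_queries_end:
  assumes w0: "\<And>i. w 0 i" and j: "j < m"
  shows "active_queries w m (m + j * m) = {i. i < m \<and> \<not> w j i}"
proof (cases "j = 0")
  case True
  have "active_queries w m t = {}" if "t \<le> m" for t
    using that by (induction t) auto
  then show ?thesis using True w0 by auto
next
  case False
  \<comment> \<open>Only positions below \<open>r\<close> are described, since the others may still
    hold the old query; at \<open>r = m\<close> all have been rewritten.\<close>
  have "active_queries w m (j * m + r) \<inter> {..<r} = {i. i < r \<and> \<not> w j i}" if "r \<le> m" for r
    using that
  proof (induction r)
    case (Suc r)
    then have r: "r < m" by simp
    have "j * m + r < Suc j * m" using r by simp
    also have "\<dots> \<le> m * m" using j by (intro mult_right_mono) auto
    finally have 1: "\<not> j * m + r \<ge> m * m" by simp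
    have 2: "\<not> j * m + r < m" using False by (cases j) auto
    have 3: "(j * m + r) div m = j" "(j * m + r) mod m = r" using r by auto
    have IH: "active_queries w m (j * m + r) \<inter> {..<r} = {i. i < r \<and> \<not> w j i}"
      using Suc.IH r by simp
    have "active_queries w m (j * m + Suc r) = (if w j r then active_queries w m (j * m + r) - {r}
        else insert r (active_queries w m (j * m + r)))"
      unfolding add_Suc_right active_queries.simps 3 by (simp only: 1 2 if_False simp_thms)
    then have "active_queries w m (j * m + Suc r) \<inter> {..<Suc r}
        = (active_queries w m (j * m + r) \<inter> {..<r}) \<union> (if w j r then {} else {r})"
      by (auto simp: lessThan_Suc)
    also have "\<dots> = {i. i < Suc r \<and> \<not> w j i}"
      unfolding IH by (auto simp: less_Suc_eq)
    finally show ?case .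
  qed simp
  from this[of m] show ?thesis using active_queries_subset[of w m "m + j * m"]
    by (simp add: add.commute Int_absorb2)
qed

lemma query_stream_dynamic:
  assumes "3 * m \<le> n"
  shows "query_stream w m T X \<in> dynamic_streams {..<n} T"
proof -
  have "data_edge i \<in> possible_edges {..<n}" "query_edge i \<in> possible_edges {..<n}" if "i < m" for i
    using that assms by (auto simp: possible_edges_def data_edge_def query_edge_def)
  moreover have "t mod m < m" if "t < m * m" for t
    using that by (intro mod_less_divisor) (auto intro: gr0I)
  ultimately show ?thesis
    by (auto simp: dynamic_streams_def query_stream_def stream_update_def)
qed

lemma query_stream_restricted:
  assumes "3 * m \<le> n" "m > 0"
  shows "query_stream w m T X \<in> restricted_streams {..<n} T"
  unfolding restricted_streams_def
proof (intro CollectI conjI allI impI)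
  show "query_stream w m T X \<in> dynamic_streams {..<n} T"
    by (rule query_stream_dynamic[OF assms(1)])
  fix t assume t: "t \<le> T"
  show "bipartite {..<n} (graph_after (query_stream w m T X) t)"
    unfolding graph_after_query_stream[OF t]
    by (rule bipartite_path_graph[OF _ active_queries_subset assms(1)]) auto
  show "max_degree {..<n} (graph_after (query_stream w m T X) t) \<le> 2"
    unfolding graph_after_query_stream[OF t] using assms by (intro max_degree_path_graph) simp
  show "arboricity (graph_after (query_stream w m T X) t) \<le> 1"
    unfolding graph_after_query_stream[OF t] by (intro arboricity_le_1 forest_path_graph)
qed

lemma query_stream_neighboring:
  assumes "i < m" "m \<le> T" "i \<notin> X"
  shows "edge_neighboring (query_stream w m T X) (query_stream w m T (insert i X))"
  unfolding edge_neighboring_def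
  using assms by (auto simp: query_stream_def stream_update_def intro!: exI[of _ i])

lemma edge_neighboring_sym: "edge_neighboring S S' \<Longrightarrow> edge_neighboring S' S"
  unfolding edge_neighboring_def by metis

text \<open>Up to a term independent of \<open>X\<close>, the answer is the inner product of
  \<open>X\<close> with the 0/1 row \<open>w j\<close>.\<close>

lemma max_matching_size_query_stream:
  assumes w0: "\<And>i. w 0 i" and j: "j < m" and T: "m * m \<le> T" and X: "X \<subseteq> {..<m}"
  shows "real (max_matching_size (graph_after (query_stream w m T X) (m + j * m)))
    = real (card {i. i < m \<and> \<not> w j i}) + (\<Sum>i<m. of_bool (w j i) * indicator X i)"
proof -
  have "m + j * m = Suc j * m" by simp
  also have "\<dots> \<le> m * m" using j by (intro mult_right_mono) auto
  finally have t: "m + j * m \<le> T" using T by simp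
  let ?Q = "{i. i < m \<and> \<not> w j i}"
  have fin: "finite X" using X by (rule finite_subset) simp
  have "X \<inter> {..<min (m + j * m) m} = X" using X by auto
  then have "max_matching_size (graph_after (query_stream w m T X) (m + j * m)) = card (X \<union> ?Q)"
    unfolding graph_after_query_stream[OF t] active_queries_end[of w, OF w0 j]
    using fin by (simp add: max_matching_size_path_graph)
  also have "X \<union> ?Q = ?Q \<union> (X - ?Q)" by auto
  also have "card \<dots> = card ?Q + card (X - ?Q)"
    using fin by (intro card_Un_disjoint) auto
  finally have *: "max_matching_size (graph_after (query_stream w m T X) (m + j * m))
    = card ?Q + card (X - ?Q)" .
  have "(\<Sum>i<m. of_bool (w j i) * indicator X i :: real) = (\<Sum>i<m. indicator (X - ?Q) i)"
    by (intro sum.cong) (auto simp: indicator_def)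
  also have "\<dots> = real (card ({..<m} \<inter> (X - ?Q)))" by (simp add: sum_indicator_real)
  also have "{..<m} \<inter> (X - ?Q) = X - ?Q" using X by auto
  finally show ?thesis using * by simp
qed

section \<open>The lower bound\<close>

text \<open>Privacy yields two distant databases consistent with the same outputs. All Hadamard
  coefficients of their difference are then of order \<open>\<zeta>\<close>, which Parseval's
  identity turns into a bound on their distance.\<close>

lemma sqrt_lower_bound_from_queries:
  fixes A :: "nat update list \<Rightarrow> (nat \<Rightarrow> real) measure"
  assumes m: "m = 2 ^ k" and n: "3 * m \<le> n" and T: "m * m \<le> T" and \<zeta>: "\<zeta> \<ge> 0"
    and mech: "continual_release_mechanism {..<n} T A"
    and dp: "edge_differentially_private 1 {..<n} T A"
    and acc: "matching_accurate_on (restricted_streams {..<n} T) T 0.99 \<zeta> A"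
  shows "real m \<le> 288 * \<zeta>\<^sup>2"
proof -
  have m0: "m > 0" using m by simp
  have mT: "m \<le> T" using T m0 by (meson le_trans le_square)
  \<comment> \<open>An entry 1 leaves the path without its query edge, so that its bit is counted.
    Row 0 is constantly 1, which makes query 0 empty.\<close>
  define w where "w j i \<longleftrightarrow> hadamard k j i = 1" for j i
  have w0: "w 0 i" for i by (simp add: w_def)
  define S where "S = query_stream w m T"
  define size where "size X t = real (max_matching_size (graph_after (S X) t))" for X t
  define G where "G X = {y \<in> space (output_space T). \<forall>t\<in>{1..T}. \<bar>y t - size X t\<bar> \<le> \<zeta>}" for X
  have S: "S X \<in> dynamic_streams {..<n} T" "S X \<in> restricted_streams {..<n} T" for X
    unfolding S_def using query_stream_dynamic[OF n] query_stream_restricted[OF n m0] by auto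
  have A: "prob_space (A (S X))" "sets (A (S X)) = sets (output_space T)" for X
    using mech S(1) unfolding continual_release_mechanism_def by blast+
  obtain X X' y where X: "X \<subseteq> {..<m}" "X' \<subseteq> {..<m}" and y: "y \<in> G X" "y \<in> G X'"
    and far: "real (card (sym_diff X X')) > real m / 8"
  proof (rule private_ambiguous_databases[of m "\<lambda>X. A (S X)" "output_space T" G])
    fix X i Y assume a: "X \<subseteq> {..<m}" "i < m" "i \<notin> X" "Y \<in> sets (output_space T)"
    have "edge_neighboring (S X) (S (insert i X))"
      unfolding S_def using a mT by (intro query_stream_neighboring) auto
    then show "measure (A (S X)) Y \<le> exp 1 * measure (A (S (insert i X))) Y \<and>
        measure (A (S (insert i X))) Y \<le> exp 1 * measure (A (S X)) Y"
      using dp S(1) a(4) edge_neighboring_sym unfolding edge_differentially_private_def by blast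
  next
    fix X
    show "G X \<in> sets (output_space T)" unfolding G_def by measurable
    have sp: "space (A (S X)) = space (output_space T)" by (intro sets_eq_imp_space_eq A)
    show "measure (A (S X)) (G X) \<ge> 0.99"
      using bspec[OF acc[unfolded matching_accurate_on_def] S(2)[of X]]
      unfolding G_def size_def sp .
  qed (use m0 A in auto)
  define z :: "nat \<Rightarrow> real" where "z i = indicator X i - indicator X' i" for i
  \<comment> \<open>One \<open>y\<close> is within \<open>\<zeta>\<close> of both true answers, and
    the term independent of the database cancels in their difference.\<close>
  have small: "\<bar>\<Sum>i<m. of_bool (w j i) * z i\<bar> \<le> 2 * \<zeta>" if j: "j < m" for j
  proof -
    have "Suc j * m \<le> m * m" using j by (intro mult_right_mono) auto
    then have "m + j * m \<in> {1..T}" using T m0 by auto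
    then have "\<bar>y (m + j * m) - size X (m + j * m)\<bar> \<le> \<zeta>" "\<bar>y (m + j * m) - size X' (m + j * m)\<bar> \<le> \<zeta>"
      using y unfolding G_def by blast+
    then have "\<bar>size X (m + j * m) - size X' (m + j * m)\<bar> \<le> 2 * \<zeta>" by linarith
    moreover have "size X (m + j * m) - size X' (m + j * m) = (\<Sum>i<m. of_bool (w j i) * z i)"
      unfolding size_def S_def max_matching_size_query_stream[of w, OF w0 j T X(1)]
        max_matching_size_query_stream[of w, OF w0 j T X(2)] z_def
      by (simp add: sum_subtractf algebra_simps)
    ultimately show ?thesis by simp
  qed
  \<comment> \<open>A sign is twice its 0/1 indicator minus 1, and row 0 supplies the constant 1;
    hence the error 2 * 2 + 2 = 6 times \<open>\<zeta>\<close>.\<close>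
  have row: "(\<Sum>i<m. hadamard k j i * z i)\<^sup>2 \<le> (6 * \<zeta>)\<^sup>2" if j: "j < m" for j
  proof -
    have "(\<Sum>i<m. hadamard k j i * z i) = (\<Sum>i<m. 2 * (of_bool (w j i) * z i) - of_bool (w 0 i) * z i)"
    proof (intro sum.cong refl)
      fix i
      show "hadamard k j i * z i = 2 * (of_bool (w j i) * z i) - of_bool (w 0 i) * z i"
        using hadamard_cases[of k j i] by (auto simp: w_def)
    qed
    also have "\<dots> = 2 * (\<Sum>i<m. of_bool (w j i) * z i) - (\<Sum>i<m. of_bool (w 0 i) * z i)"
      by (simp only: sum_subtractf sum_distrib_left)
    finally have "\<bar>\<Sum>i<m. hadamard k j i * z i\<bar> \<le> 6 * \<zeta>"
      using small[OF j] small[OF m0] by linarith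
    then show ?thesis using \<zeta> by (subst abs_le_square_iff[symmetric]) simp
  qed
  have "(\<Sum>i<m. (z i)\<^sup>2) = (\<Sum>i<m. indicator (sym_diff X X') i)"
    by (intro sum.cong) (auto simp: z_def indicator_def)
  also have "\<dots> = real (card ({..<m} \<inter> sym_diff X X'))" by (simp add: sum_indicator_real)
  also have "{..<m} \<inter> sym_diff X X' = sym_diff X X'" using X by blast
  \<comment> \<open>The entries of \<open>z\<close> are 0, 1 or -1, so its squared norm is the
    distance of the databases. Comparing \<open>m / 8\<close> with
    \<open>36 * \<zeta>\<^sup>2\<close> gives the constant 288 = 8 * 36.\<close>
  finally have "real m * (real m / 8) \<le> real m * (\<Sum>i<m. (z i)\<^sup>2)"
    using far by (intro mult_left_mono) auto
  also have "\<dots> = (\<Sum>j<m. (\<Sum>i<m. hadamard k j i * z i)\<^sup>2)"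
    unfolding m by (simp add: hadamard_parseval)
  also have "\<dots> \<le> (\<Sum>j<m. (6 * \<zeta>)\<^sup>2)" by (intro sum_mono row) auto
  also have "\<dots> = real m * (36 * \<zeta>\<^sup>2)" by (simp add: power_mult_distrib)
  finally show ?thesis using m0 by simp
qed

text \<open>Take the last \<open>k\<close> before a constraint fails. Failure at
  \<open>k + 1\<close> means that \<open>n\<close> is below \<open>6 * 2 ^ k\<close> or
  \<open>T\<close> is below \<open>4 * 4 ^ k\<close>.\<close>

lemma power_of_2_scale:
  assumes n: "n \<ge> 3" and T: "T > 0"
  obtains k where "3 * 2 ^ k \<le> n" "2 ^ k * 2 ^ k \<le> T"
    "min (sqrt (real n)) (real T powr (1/4)) \<le> sqrt (6 * 2 ^ k)"
proof -
  define ok where "ok k \<longleftrightarrow> 3 * 2 ^ k \<le> n \<and> 2 ^ k * 2 ^ k \<le> T" for k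
  have "ok 0" using assms by (simp add: ok_def)
  \<comment> \<open>This bound guarantees that the constraints fail eventually.\<close>
  moreover have "k < n" if "ok k" for k
    using that less_exp[of k] unfolding ok_def by linarith
  ultimately obtain k where k: "ok k" "\<not> ok (Suc k)"
    by (metis less_irrefl nat_induct)
  have "min (sqrt (real n)) (real T powr (1/4)) \<le> sqrt (6 * 2 ^ k)"
  proof (cases "n < 3 * 2 ^ Suc k")
    case True
    then have "real n \<le> real (3 * 2 ^ Suc k)" by linarith
    then have "sqrt (real n) \<le> sqrt (6 * 2 ^ k)" by simp
    then show ?thesis by linarith
  next
    case False
    then have "T \<le> 2 ^ Suc k * 2 ^ Suc k" using k(2) by (simp add: ok_def)
    then have "real T \<le> real (2 ^ Suc k * 2 ^ Suc k)" by linarith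
    also have "\<dots> = sqrt (2 * 2 ^ k) ^ 4" by (simp add: power4_eq_xxxx)
    also have "\<dots> \<le> sqrt (6 * 2 ^ k) ^ 4" by (intro power_mono) auto
    finally have "real T powr (1/4) \<le> (sqrt (6 * 2 ^ k) ^ 4) powr (1/4)"
      by (intro powr_mono2) auto
    also have "\<dots> = sqrt (6 * 2 ^ k)"
      using powr_powr[of "sqrt (6 * 2 ^ k)" 4 "1/4"] powr_realpow[of "sqrt (6 * 2 ^ k)" 4]
      by simp
    finally show ?thesis by linarith
  qed
  then show ?thesis using that k(1) by (auto simp: ok_def)
qed

lemma restricted_streams_lower_bound:
  fixes A :: "nat update list \<Rightarrow> (nat \<Rightarrow> real) measure"
  assumes n: "n \<ge> 3" and \<zeta>: "\<zeta> \<ge> 0"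
    and A: "continual_release_mechanism {..<n} T A" "edge_differentially_private 1 {..<n} T A"
      "matching_accurate_on (restricted_streams {..<n} T) T 0.99 \<zeta> A"
  shows "\<zeta> \<ge> 1 / 42 * min (sqrt (real n)) (real T powr (1/4))"
proof (cases "T = 0")
  \<comment> \<open>Here \<open>0 powr (1/4) = 0\<close>, so the claimed bound is 0.\<close>
  case True
  then show ?thesis using \<zeta> by simp
next
  case False
  then obtain k where k: "3 * 2 ^ k \<le> n" "2 ^ k * 2 ^ k \<le> T"
    and le: "min (sqrt (real n)) (real T powr (1/4)) \<le> sqrt (6 * 2 ^ k)"
    using power_of_2_scale[OF n] by blast
  have "6 * real (2 ^ k) \<le> 6 * (288 * \<zeta>\<^sup>2)"
    by (intro mult_left_mono sqrt_lower_bound_from_queries[OF refl k \<zeta> A]) simp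
  \<comment> \<open>The constant 42 comes from 6 * 288 = 1728, which is at most 42 * 42 =
    1764.\<close>
  also have "6 * (288 * \<zeta>\<^sup>2) \<le> (42 * \<zeta>)\<^sup>2" by (simp add: power_mult_distrib)
  finally have "6 * 2 ^ k \<le> (42 * \<zeta>)\<^sup>2" by simp
  then have "sqrt (6 * 2 ^ k) \<le> 42 * \<zeta>" using \<zeta> by (intro real_le_lsqrt) auto
  then show ?thesis using le by simp
qed

theorem theorem8p3:
  "(\<exists>c>0. \<exists>N. \<forall>n\<ge>N. \<forall>T. \<forall>\<zeta>\<ge>0. \<forall>A :: nat update list \<Rightarrow> (nat \<Rightarrow> real) measure.
      continual_release_mechanism {..<n} T A \<longrightarrow>
      edge_differentially_private 1 {..<n} T A \<longrightarrow>
      matching_accurate_on (dynamic_streams {..<n} T) T 0.99 \<zeta> A \<longrightarrow>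
      \<zeta> \<ge> c * min (sqrt (real n)) (real T powr (1/4))) \<and>
   (\<exists>c>0. \<exists>N. \<forall>n\<ge>N. \<forall>T. \<forall>\<zeta>\<ge>0. \<forall>A :: nat update list \<Rightarrow> (nat \<Rightarrow> real) measure.
      continual_release_mechanism {..<n} T A \<longrightarrow>
      edge_differentially_private 1 {..<n} T A \<longrightarrow>
      matching_accurate_on (restricted_streams {..<n} T) T 0.99 \<zeta> A \<longrightarrow>
      \<zeta> \<ge> c * min (sqrt (real n)) (real T powr (1/4)))"
proof -
  \<comment> \<open>Accuracy on all streams includes accuracy on the restricted ones, so the first
    claim follows from the second with the same constants.\<close>
  have sub: "matching_accurate_on (restricted_streams {..<n} T) T 0.99 \<zeta> A"
    if "matching_accurate_on (dynamic_streams {..<n} T) T 0.99 \<zeta> A"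
    for n T \<zeta> and A :: "nat update list \<Rightarrow> (nat \<Rightarrow> real) measure"
    using that unfolding matching_accurate_on_def restricted_streams_def by blast
  show ?thesis
    by (intro conjI exI[of _ "1/42"] exI[of _ 3] allI impI restricted_streams_lower_bound)
      (assumption | rule sub | simp)+
qed

end
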